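(* The edge generating series of the Schröder lattices is $$\sum_{n\ge0}\ell(\mathcal{S}_n)x^n=\frac{(1-x)\big(1-4x+x^2-(1-x)\sqrt{1-6x+x^2}\big)}{2x\sqrt{1-6x+x^2}}.$$ Moreover, for $n\ge1$, $\ell(\mathcal{S}_n)=d_n-r_n-d_{n-1}+r_{n-1}$, and for $n\ge0$ $$\ell(\mathcal{S}_n)=\sum_{k=0}^n\left(\!\!\binom{2k}{n-k}\!\!\right)\binom{2k}{k}\frac{k}{k+1},$$ where $\left(\!\binom{m}{j}\!\right)=\frac{m(m+1)\cdots(m+j-1)}{j!}$ is the multiset coefficient. Finally, $\ell(\mathcal{S}_n)\sim\frac{(1+\sqrt2)^{2n}}{\sqrt{\sqrt2\,n\pi}}$ and $i(\mathcal{S}_n)=\ell(\mathcal{S}_n)/|\mathcal{S}_n|\sim(2-\sqrt2)n$.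
   Context: Steps: $U=(1,1)$, $D=(1,-1)$, $H=(2,0)$. $\mathcal{S}_n$ is the set of Schröder paths of semi-length $n$ (lattice paths from $(0,0)$ to $(2n,0)$ with steps $U,D,H$ never going below the $x$-axis), partially ordered by $\gamma_1\le\gamma_2$ iff $\gamma_1$ lies weakly below $\gamma_2$. $\ell(P)$ is the number of edges (covering pairs) of the Hasse diagram of a finite poset $P$ and $i(P)=\ell(P)/|P|$. $d_n$ are the central Delannoy numbers, $\sum_n d_nx^n=1/\sqrt{1-6x+x^2}$, and $r_n=|\mathcal{S}_n|$ are the large Schröder numbers, $\sum_nr_nx^n=(1-x-\sqrt{1-6x+x^2})/(2x)$. $a_n\sim b_n$ means $a_n/b_n\to1$. *)

theory Defs
  imports "HOL-Analysis.Analysis"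
begin

text \<open>Steps of a Schroeder path: U = (1,1), D = (1,-1), H = (2,0).\<close>
datatype step = U | D | H

text \<open>Unit-abscissa height increments: an H step is split into two flat unit pieces.\<close>
fun incs_step :: "step \<Rightarrow> int list" where
  "incs_step U = [1]"
| "incs_step D = [-1]"
| "incs_step H = [0, 0]"

definition incs :: "step list \<Rightarrow> int list" where
  "incs p = concat (map incs_step p)"

definition ht :: "step list \<Rightarrow> nat \<Rightarrow> int" where
  "ht p i = sum_list (take i (incs p))"

definition schroeder :: "nat \<Rightarrow> step list set" where
  "schroeder n = {p. length (incs p) = 2 * n \<and> (\<forall>i \<le> 2 * n. 0 \<le> ht p i) \<and> ht p (2 * n) = 0}"

text \<open>p lies weakly below q (both paths being piecewise linear with breakpoints at
  integer abscissae, comparing heights at integer abscissae suffices).\<close>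
definition below :: "nat \<Rightarrow> step list \<Rightarrow> step list \<Rightarrow> bool" where
  "below n p q \<longleftrightarrow> (\<forall>i \<le> 2 * n. ht p i \<le> ht q i)"

definition hasse_edges :: "'a set \<Rightarrow> ('a \<Rightarrow> 'a \<Rightarrow> bool) \<Rightarrow> ('a \<times> 'a) set" where
  "hasse_edges S le = {(a, b). a \<in> S \<and> b \<in> S \<and> le a b \<and> a \<noteq> b \<and>
      \<not> (\<exists>c\<in>S. le a c \<and> a \<noteq> c \<and> le c b \<and> c \<noteq> b)}"

definition ell :: "'a set \<Rightarrow> ('a \<Rightarrow> 'a \<Rightarrow> bool) \<Rightarrow> nat" where
  "ell S le = card (hasse_edges S le)"

definition index_poset :: "'a set \<Rightarrow> ('a \<Rightarrow> 'a \<Rightarrow> bool) \<Rightarrow> real" where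
  "index_poset S le = real (ell S le) / real (card S)"

definition ellS :: "nat \<Rightarrow> nat" where
  "ellS n = ell (schroeder n) (below n)"

definition schr :: "nat \<Rightarrow> nat" where
  "schr n = card (schroeder n)"

text \<open>Central Delannoy numbers (standard closed form; generating function
  1/sqrt(1-6x+x^2)).\<close>
definition delannoy :: "nat \<Rightarrow> nat" where
  "delannoy n = (\<Sum>k\<le>n. (n choose k) * ((n + k) choose k))"

definition multichoose :: "nat \<Rightarrow> nat \<Rightarrow> real" where
  "multichoose m j = pochhammer (real m) j / fact j"

end

(* A pair of Schroeder paths is a covering pair iff the upper path arises from the lower one by
   replacing one H by UD or one DU by H.  Marking the H step involved, the covering pairs
   correspond to the H steps of all paths, each counted twice, or once if it lies on the axis.
   Counting paths that start at an arbitrary height h by their number of U and H steps, the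
   recursion on the first step is solved by R^(h+1) and, for the marked steps, by
   2 (h+1) x R^(h+1) D - x R^(h+2), where R and D are the generating functions of the large
   Schroeder and the central Delannoy numbers; at h = 0 this is (1 - x)(D - R).

   Both R and D are obtained from the Catalan and the central binomial series by substituting
   x / (1 - x)^2 and dividing by 1 - x, which gives the sum formula.  The asymptotics follow from
   D = (1 - a x)^(-1/2) (1 - b x)^(-1/2) with a, b = 3 +- 2 sqrt 2, by Tannery's theorem applied to
   the Cauchy product, and from 2 (n+1) r_n = 3 d_n - d_(n-1). *)
theory Submission
  imports Defs "HOL-Real_Asymp.Real_Asymp"
begin

section \<open>Paths and covering pairs\<close>

lemma incs_simps [simp]:
  "incs [] = []" "incs (U # p) = 1 # incs p" "incs (D # p) = -1 # incs p"
  "incs (H # p) = 0 # 0 # incs p" "incs (p @ q) = incs p @ incs q"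
  by (auto simp: incs_def)

section \<open>Paths from an arbitrary height to the axis, and their decomposition by the first
  step\<close>

fun descends :: "nat \<Rightarrow> step list \<Rightarrow> bool" where
  "descends h [] = (h = 0)"
| "descends h (U # p) = descends (Suc h) p"
| "descends h (D # p) = (0 < h \<and> descends (h - 1) p)"
| "descends h (H # p) = descends h p"

text \<open>For a path from height \<open>h\<close> down to the axis, the length is \<open>2 * weight + h\<close>; hence the
  weight of a Schroeder path is its semi-length.\<close>
fun weight :: "step list \<Rightarrow> nat" where
  "weight [] = 0"
| "weight (U # p) = Suc (weight p)"
| "weight (D # p) = weight p"
| "weight (H # p) = Suc (weight p)"

lemma weight_append [simp]: "weight (p @ q) = weight p + weight q"
  by (induction p rule: weight.induct) auto

definition paths :: "nat \<Rightarrow> nat \<Rightarrow> step list set" where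
  "paths h n = {p. descends h p \<and> weight p = n}"

lemma all_le_Suc_iff: "(\<forall>i\<le>Suc n. Q i) \<longleftrightarrow> Q 0 \<and> (\<forall>i\<le>n. Q (Suc i))"
  by (metis Suc_le_mono le0 not0_implies_Suc)

text \<open>The midpoint of an \<open>H\<close> repeats the height before it, so checking all
  integer abscissae asks no more than checking the vertices.\<close>

lemma descends_iff:
  "descends h p \<longleftrightarrow> (\<forall>i \<le> length (incs p). 0 \<le> int h + ht p i) \<and> int h + sum_list (incs p) = 0"
proof (induction h p rule: descends.induct)
  case (3 h p)
  show ?case
  proof (cases h)
    case 0
    then show ?thesis
      \<comment> \<open>From height 0 a leading \<open>D\<close> violates nonnegativity at abscissa
        1.\<close>
      by (auto simp: ht_def intro!: exI[of _ 1])
  next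
    case (Suc k)
    with 3 show ?thesis
      by (simp add: ht_def all_le_Suc_iff add.assoc [symmetric])
  qed
qed (auto simp: ht_def all_le_Suc_iff ac_simps)

lemma length_incs: "int (length (incs p)) = 2 * int (weight p) - sum_list (incs p)"
  by (induction p rule: weight.induct) auto

lemma schroeder_eq_paths: "schroeder n = paths 0 n"
proof -
  have "p \<in> schroeder n \<longleftrightarrow> p \<in> paths 0 n" for p
  proof -
    have "length (incs p) = 2 * n \<longleftrightarrow> weight p = n" if "sum_list (incs p) = 0"
      using length_incs[of p] that by linarith
    then show ?thesis
      by (auto simp: schroeder_def paths_def descends_iff ht_def)
  qed
  then show ?thesis by blast
qed

lemma paths_rec:
  "paths h n = (if h = 0 \<and> n = 0 then {[]} else {})
     \<union> (if n = 0 then {} else (#) U ` paths (Suc h) (n - 1) \<union> (#) H ` paths h (n - 1))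
     \<union> (if h = 0 then {} else (#) D ` paths (h - 1) n)" (is "_ = ?R")
proof -
  have "p \<in> paths h n \<longleftrightarrow> p \<in> ?R" for p
    by (cases "(h, p)" rule: descends.cases) (auto simp: paths_def image_iff)
  then show ?thesis by blast
qed

text \<open>A leading \<open>D\<close> keeps the weight and lowers the height, so the induction runs
  over the weight and, inside, over the height.\<close>

lemma finite_paths: "finite (paths h n)"
proof (induction n arbitrary: h)
  case 0
  show ?case
    by (induction h) (subst paths_rec; simp)+
next
  case (Suc n)
  show ?case
    by (induction h) (subst paths_rec; simp add: Suc)+
qed

lemma sum_paths_rec:
  fixes f :: "step list \<Rightarrow> 'a::comm_monoid_add"
  shows "sum f (paths h n) = (if h = 0 \<and> n = 0 then f [] else 0)
     + (if n = 0 then 0 else (\<Sum>p\<in>paths (Suc h) (n - 1). f (U # p)) + (\<Sum>p\<in>paths h (n - 1). f (H # p)))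
     + (if h = 0 then 0 else (\<Sum>p\<in>paths (h - 1) n. f (D # p)))"
proof -
  have *: "sum f ((#) s ` A) = (\<Sum>p\<in>A. f (s # p))" for s A
    by (subst sum.reindex) (auto simp: inj_on_def)
  have UH: "(#) U ` A \<inter> (#) H ` B = {}" for A B
    by auto
  show ?thesis
    by (subst paths_rec, (subst sum.union_disjoint; (auto simp: finite_paths; fail)?)+)
       (simp add: * sum.union_disjoint finite_paths UH)
qed

text \<open>An \<open>H\<close> step is the lower end of one covering pair, and the upper end of
  another one unless it lies on the axis.\<close>
fun flips :: "nat \<Rightarrow> step list \<Rightarrow> nat" where
  "flips h [] = 0"
| "flips h (U # p) = flips (Suc h) p"
| "flips h (D # p) = flips (h - 1) p"
| "flips h (H # p) = (if h = 0 then 1 else 2) + flips h p"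

section \<open>Marked \<open>H\<close> steps and the pairs of paths that they encode\<close>

lemma card_image_Cons_fst: "card ((\<lambda>(u, x). (s # u, x)) ` A) = card A"
  by (rule card_image) (auto simp: inj_on_def)

text \<open>The flag \<open>b\<close> selects the covering pair. True makes the marked
  \<open>H\<close> the lower end, to be raised to \<open>UD\<close>; False makes it the upper end,
  lying over \<open>DU\<close>, which needs a positive height.\<close>

definition marked :: "nat \<Rightarrow> step list \<Rightarrow> (step list \<times> step list \<times> bool) set" where
  "marked h p = {(u, v, b). p = u @ H # v \<and> (b \<or> 0 < int h + sum_list (incs u))}"

lemma marked_Cons:
  "marked h (s # p) = (\<lambda>(u, v, b). (s # u, v, b)) ` marked (nat (int h + sum_list (incs [s]))) p
     \<union> (if s = H then {[]} \<times> {p} \<times> {b. b \<or> 0 < h} else {})"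
  if "0 \<le> int h + sum_list (incs [s])"
proof -
  have "(u, v, b) \<in> marked h (s # p) \<longleftrightarrow> 
     (u, v, b) \<in> (\<lambda>(u, v, b). (s # u, v, b)) ` marked (nat (int h + sum_list (incs [s]))) p
     \<union> (if s = H then {[]} \<times> {p} \<times> {b. b \<or> 0 < h} else {})" for u v b
    using that by (cases u; cases s) (auto simp: marked_def image_iff add.assoc)
  then show ?thesis by auto
qed

lemma card_marked: "descends h p \<Longrightarrow> finite (marked h p) \<and> card (marked h p) = flips h p"
proof (induction h p rule: descends.induct)
  case (1 h)
  have "marked h [] = {}" by (auto simp: marked_def)
  then show ?case by simp
next
  case (2 h p)
  then show ?case
    by (subst (1 2) marked_Cons)
       (auto simp: card_image_Cons_fst nat_add_distrib)
next
  case (3 h p)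
  then show ?case
    by (subst (1 2) marked_Cons)
       (auto simp: card_image_Cons_fst nat_diff_distrib)
next
  case (4 h p)
  have "{b. b \<or> 0 < h} = (if h = 0 then {True} else {True, False})"
    by auto
  then have "card {b. b \<or> 0 < h} = (if h = 0 then 1 else 2)"
    by simp
  then have "card ({[] :: step list} \<times> {p} \<times> {b. b \<or> 0 < h}) = (if h = 0 then 1 else 2)"
    by (simp add: card_cartesian_product)
  moreover have "finite (marked h p)" "card (marked h p) = flips h p" using 4 by auto
  moreover have "marked h (H # p) = 
      (\<lambda>(u, x). (H # u, x)) ` marked h p \<union> {[]} \<times> {p} \<times> {b. b \<or> 0 < h}"
    by (subst marked_Cons) auto
  moreover have "(\<lambda>(u, x). (H # u, x)) ` marked h p \<inter> {[]} \<times> {p} \<times> {b. b \<or> 0 < h} = {}"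
    by auto
  ultimately show ?case
    by (simp add: card_Un_disjoint card_image_Cons_fst del: Times_insert_left)
qed

lemma descends_peak: "descends h (u @ U # D # v) \<longleftrightarrow> descends h (u @ H # v)"
  by (induction h u rule: descends.induct) auto

text \<open>The bottom of \<open>DU\<close> lies one below the end of \<open>u\<close>; this is the
  only height that \<open>H\<close> does not already control.\<close>

lemma descends_valley:
  "descends h (u @ D # U # v) \<longleftrightarrow> descends h (u @ H # v) \<and> 0 < int h + sum_list (incs u)"
  by (induction h u rule: descends.induct) (auto simp: of_nat_diff add.assoc)

definition flip_pair :: "step list \<times> step list \<times> bool \<Rightarrow> step list \<times> step list" where
  "flip_pair = (\<lambda>(u, v, b). if b then (u @ H # v, u @ U # D # v) else (u @ D # U # v, u @ H # v))"

text \<open>Two lists that differ right after \<open>u\<close> have \<open>u\<close> as their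
  longest common prefix, and this prefix is unique.\<close>

lemma append_Cons_unique:
  assumes "u @ s # v = u' @ s' # v'" "u @ t # w = u' @ t' # w'" "s \<noteq> t" "s' \<noteq> t'"
  shows "u = u'"
  using assms
proof (induction u arbitrary: u')
  case Nil
  then show ?case by (cases u') auto
next
  case (Cons a u)
  then show ?case by (cases u') auto
qed

text \<open>The common prefix of the two paths gives back \<open>u\<close>; the next step of the
  lower path, \<open>H\<close> or \<open>D\<close>, gives back \<open>b\<close>.\<close>

lemma inj_flip_pair: "inj flip_pair"
proof (rule injI)
  fix x y assume eq: "flip_pair x = flip_pair y"
  obtain u v b where x: "x = (u, v, b)" by (cases x)
  obtain u' v' b' where y: "y = (u', v', b')" by (cases y)
  have "u = u'"
    using eq by (cases b; cases b') (auto simp: x y flip_pair_def elim!: append_Cons_unique)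
  with eq show "x = y"
    by (cases b; cases b') (auto simp: x y flip_pair_def)
qed

definition marked_paths :: "nat \<Rightarrow> (step list \<times> step list \<times> bool) set" where
  "marked_paths n = (\<Union>p\<in>paths 0 n. marked 0 p)"

text \<open>For a peak, either path of the pair is valid iff the other is. For a valley, validity of
  the lower path amounts to validity of the upper one plus the height condition in
  \<open>marked\<close>.\<close>

lemma flip_pair_marked_paths:
  "flip_pair ` marked_paths n = paths 0 n \<times> paths 0 n \<inter> range flip_pair"
proof -
  have *: "(u, v, b) \<in> marked_paths n \<longleftrightarrow> flip_pair (u, v, b) \<in> paths 0 n \<times> paths 0 n" for u v b
    using descends_valley[of 0 u v]
    by (auto simp: flip_pair_def marked_paths_def marked_def paths_def descends_peak)
  have "x \<in> marked_paths n \<longleftrightarrow> x \<in> flip_pair -` (paths 0 n \<times> paths 0 n)" for x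
    by (cases x) (simp only: * vimage_eq)
  then have "marked_paths n = flip_pair -` (paths 0 n \<times> paths 0 n)"
    by (rule set_eqI)
  then show ?thesis by (simp add: image_vimage_eq)
qed

lemma card_marked_paths: "card (marked_paths n) = (\<Sum>p\<in>paths 0 n. flips 0 p)"
proof -
  have "card (marked_paths n) = (\<Sum>p\<in>paths 0 n. card (marked 0 p))"
    unfolding marked_paths_def
  proof (rule card_UN_disjoint)
    show "\<forall>p\<in>paths 0 n. finite (marked 0 p)"
      using card_marked by (auto simp: paths_def)
  qed (auto simp: finite_paths marked_def)
  also have "\<dots> = (\<Sum>p\<in>paths 0 n. flips 0 p)"
    by (rule sum.cong) (auto simp: card_marked paths_def)
  finally show ?thesis .
qed

section \<open>The order on paths and its covering pairs\<close>

lemma incs_eq_iff: "incs p = incs q \<longleftrightarrow> p = q"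
proof (induction p arbitrary: q)
  case Nil
  then show ?case
    by (cases q rule: weight.cases) auto
next
  case (Cons s p)
  then show ?case
    by (cases s; cases q rule: weight.cases) auto
qed

lemma eq_if_sum_take_eq:
  fixes xs ys :: "int list"
  assumes "length xs = length ys" "\<And>i. i \<le> length xs \<Longrightarrow> sum_list (take i xs) = sum_list (take i ys)"
  shows "xs = ys"
proof (rule nth_equalityI)
  fix i assume "i < length xs"
  with assms(2)[of i] assms(2)[of "Suc i"] assms(1) show "xs ! i = ys ! i"
    by (simp add: take_Suc_conv_app_nth)
qed (rule assms(1))

lemma below_antisym:
  assumes "p \<in> schroeder n" "q \<in> schroeder n" "below n p q" "below n q p"
  shows "p = q"
proof -
  have "incs p = incs q"
  proof (rule eq_if_sum_take_eq)
    show "length (incs p) = length (incs q)"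
      using assms(1,2) by (simp add: schroeder_def)
    fix i assume "i \<le> length (incs p)"
    with assms(1) have "i \<le> 2 * n" by (simp add: schroeder_def)
    with assms(3,4) have "ht p i = ht q i"
      unfolding below_def by (metis order_antisym)
    then show "sum_list (take i (incs p)) = sum_list (take i (incs q))"
      by (simp add: ht_def)
  qed
  then show ?thesis by (simp add: incs_eq_iff)
qed

text \<open>Both pairs have the same total, so only the partial sum that ends between their two
  entries changes.\<close>

lemma sum_take_swap_two:
  fixes a b c d :: int
  assumes "a + b = c + d"
  shows "sum_list (take k (xs @ a # b # ys)) =
    sum_list (take k (xs @ c # d # ys)) + (if k = Suc (length xs) then a - c else 0)"
proof -
  have "k \<le> length xs \<or> k = Suc (length xs) \<or> (\<exists>j. k = length xs + Suc (Suc j))"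
    by presburger
  moreover have "b = c + d - a" using assms by simp
  ultimately show ?thesis
    by (elim disjE exE) simp_all
qed

lemma ht_flip_pair:
  assumes "(p, q) = flip_pair (u, v, b)"
  shows "ht q i = ht p i + (if i = Suc (length (incs u)) then 1 else 0)"
  using assms
    sum_take_swap_two[where k = i and a = 1 and b = "-1" and c = 0 and d = 0 and xs = "incs u" and ys = "incs v"]
    sum_take_swap_two[where k = i and a = 0 and b = "0" and c = "-1" and d = 1 and xs = "incs u" and ys = "incs v"]
  by (auto simp: flip_pair_def ht_def split: if_splits)

lemma flip_pair_below:
  assumes "(p, q) \<in> range flip_pair"
  obtains j where "\<And>i. ht q i = ht p i + (if i = j then 1 else 0)" "below n p q" "p \<noteq> q"
proof -
  from assms obtain u v b where uvb: "(p, q) = flip_pair (u, v, b)" by auto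
  note ht = ht_flip_pair[OF this]
  show ?thesis
  proof (rule that[OF ht])
    show "below n p q" by (simp add: below_def ht)
    show "p \<noteq> q" using ht[of "Suc (length (incs u))"] by auto
  qed
qed

lemma ht_append_left: "i \<le> length (incs u) \<Longrightarrow> ht (u @ v) i = ht u i"
  by (simp add: ht_def)

lemma even_ht: "even (ht p (length (incs p)) + int (length (incs p)))"
  by (simp add: ht_def length_incs)

text \<open>Every step changes abscissa plus height by an even amount, so this sum is even at
  vertices and odd at midpoints of \<open>H\<close> steps. Parity thus reads off the kind of point
  from the height alone.\<close>

lemma vertex_or_midpoint [consumes 1, case_names vertex midpoint]:
  assumes "i \<le> length (incs p)"
  obtains (vertex) u v where "p = u @ v" "i = length (incs u)" "even (ht p i + int i)"
  | (midpoint) u v where "p = u @ H # v" "i = Suc (length (incs u))" "odd (ht p i + int i)"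
proof -
  have "(\<exists>u v. p = u @ v \<and> i = length (incs u)) \<or> (\<exists>u v. p = u @ H # v \<and> i = Suc (length (incs u)))"
    using assms
  proof (induction p arbitrary: i)
    case Nil
    then show ?case by auto
  next
    case (Cons s p)
    define l where "l = length (incs [s])"
    have *: "length (incs (s # u)) = l + length (incs u)" for u
      by (cases s) (auto simp: l_def)
    show ?case
    proof (cases "i < l")
      case True
      then consider "i = 0" | "i = 1" "s = H" by (cases s) (auto simp: l_def less_Suc_eq)
      then show ?thesis
      proof cases
        case 1
        then show ?thesis by (intro disjI1 exI[of _ "[]"] exI[of _ "s # p"]) auto
      next
        case 2
        then show ?thesis by (intro disjI2 exI[of _ "[]"] exI[of _ "p"]) auto
      qed
    next
      case False
      from False Cons.prems have "i - l \<le> length (incs p)"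
        by (simp add: *)
      from Cons.IH[OF this] show ?thesis
      proof (elim disjE exE conjE)
        fix u v assume "p = u @ v" "i - l = length (incs u)"
        with False show ?thesis
          by (intro disjI1 exI[of _ "s # u"] exI[of _ v]) (simp add: *)
      next
        fix u v assume "p = u @ H # v" "i - l = Suc (length (incs u))"
        with False show ?thesis
          by (intro disjI2 exI[of _ "s # u"] exI[of _ v]) (simp add: *)
      qed
    qed
  qed
  then show ?thesis
  proof (elim disjE exE conjE)
    fix u v assume *: "p = u @ v" "i = length (incs u)"
    then show ?thesis
      using vertex[OF *] even_ht[of u] by (simp add: ht_append_left)
  next
    fix u v assume *: "p = u @ H # v" "i = Suc (length (incs u))"
    then have "ht p i = ht u (length (incs u))"
      by (simp add: ht_def)
    then show ?thesis
      using midpoint[OF *] even_ht[of u] * by simp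
  qed
qed

lemma ht_Suc_le: "ht p (Suc i) \<le> ht p i + 1"
  and ht_le_Suc: "ht p i \<le> ht p (Suc i) + 1"
proof -
  have "set (incs p) \<subseteq> {-1, 0, 1}"
    by (induction p rule: weight.induct) auto
  moreover have "ht p (Suc i) - ht p i = (if i < length (incs p) then incs p ! i else 0)"
    by (simp add: ht_def take_Suc_conv_app_nth)
  ultimately have "\<bar>ht p (Suc i) - ht p i\<bar> \<le> 1"
    using nth_mem[of i "incs p"] by fastforce
  then show "ht p (Suc i) \<le> ht p i + 1" "ht p i \<le> ht p (Suc i) + 1"
    by auto
qed

text \<open>An odd sum excludes a vertex, so the point is the midpoint of an \<open>H\<close> and
  the path is flat on both sides of it.\<close>

lemma ht_odd_midpoint:
  assumes "Suc i \<le> length (incs p)" "odd (ht p (Suc i) + int (Suc i))"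
  shows "ht p i = ht p (Suc i)" "ht p (Suc (Suc i)) = ht p (Suc i)"
proof -
  have "ht p i = ht p (Suc i) \<and> ht p (Suc (Suc i)) = ht p (Suc i)"
    using assms(1)
  proof (cases rule: vertex_or_midpoint)
    case (vertex u v)
    with assms(2) show ?thesis by blast
  next
    case (midpoint u v)
    then have "i = length (incs u)" by simp
    with midpoint(1) show ?thesis by (simp add: ht_def)
  qed
  then show "ht p i = ht p (Suc i)" "ht p (Suc (Suc i)) = ht p (Suc i)"
    by auto
qed

text \<open>The flip raises a single height by one, at a place where \<open>q\<close> is strictly
  higher.\<close>

lemma flip_up:
  assumes "p \<in> schroeder n" "below n p q" "(p, p') = flip_pair (u, v, b)"
    "ht p (Suc (length (incs u))) < ht q (Suc (length (incs u)))"
  shows "p' \<in> schroeder n \<and> below n p' q \<and> (p, p') \<in> range flip_pair"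
proof (intro conjI)
  note ht = ht_flip_pair[OF assms(3)]
  show "below n p' q"
    using assms by (auto simp: below_def ht)
  show "p' \<in> schroeder n"
    using assms(1,3) descends_valley[of 0 u v]
    by (auto simp: schroeder_eq_paths paths_def flip_pair_def descends_peak split: if_splits)
  show "(p, p') \<in> range flip_pair"
    using assms(3) by blast
qed

text \<open>A lattice point of minimal height among those where \<open>p\<close> is strictly below \<open>q\<close>
  is a valley of \<open>p\<close> or an end point of an \<open>H\<close> step whose midpoint is also strictly below \<open>q\<close>.\<close>
lemma exists_flip_below:
  assumes p: "p \<in> schroeder n" and q: "q \<in> schroeder n" and le: "below n p q" and ne: "p \<noteq> q"
  shows "\<exists>p'\<in>schroeder n. below n p' q \<and> (p, p') \<in> range flip_pair"
proof -
  define A where "A = {i. i \<le> 2 * n \<and> ht p i < ht q i}"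
  have lp: "length (incs p) = 2 * n" and lq: "length (incs q) = 2 * n"
    using p q by (auto simp: schroeder_def)
  have le': "ht p i \<le> ht q i" if "i \<le> 2 * n" for i
    using le that by (auto simp: below_def)
  have "A \<noteq> {}"
    using below_antisym[OF p q le] ne by (force simp: A_def below_def)
  moreover have "finite A" by (simp add: A_def)
  ultimately obtain i where i: "i \<in> A" and min: "\<And>j. j \<in> A \<Longrightarrow> ht p i \<le> ht p j"
    using arg_min_if_finite(1,2)[of A "ht p"] by (metis leI)
  from i have i_le: "i \<le> 2 * n" and i_less: "ht p i < ht q i"
    by (auto simp: A_def)
  have flip_mid: ?thesis if "p = u @ H # v" "Suc (length (incs u)) \<in> A" for u v
  proof -
    have "(p, u @ U # D # v) = flip_pair (u, v, True)"
      by (simp add: flip_pair_def that)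
    from flip_up[OF p le this] that(2) show ?thesis
      by (auto simp: A_def)
  qed
  have "i \<le> length (incs p)" using i_le lp by simp
  then show ?thesis
  proof (cases rule: vertex_or_midpoint)
    case (midpoint u v)
    with flip_mid i show ?thesis by blast
  next
    case (vertex u v)
    have "i \<noteq> 0"
      using i_less by (intro notI) (simp add: ht_def)
    have "i \<noteq> 2 * n"
      using i_less p q by (intro notI) (simp add: schroeder_def)
    with \<open>i \<noteq> 0\<close> vertex lp have "u \<noteq> []" "v \<noteq> []" by auto
    then obtain u' s t v' where u: "u = u' @ [s]" and v: "v = t # v'"
      by (metis append_butlast_last_id list.exhaust)
    obtain k where k: "i = Suc k" "Suc i \<le> 2 * n"
      using \<open>i \<noteq> 0\<close> \<open>i \<noteq> 2 * n\<close> i_le by (cases i) auto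
    \<comment> \<open>After an up step the point at \<open>k\<close> is lower, so by minimality
      \<open>q\<close> meets \<open>p\<close> there; rising by at most one, \<open>q\<close> cannot
      be above \<open>p\<close> at \<open>i\<close>. The case of \<open>D\<close> after
      \<open>i\<close> is symmetric.\<close>
    have notU: "s \<noteq> U"
    proof
      assume "s = U"
      then have "ht p k = ht p i - 1"
        using vertex k by (auto simp: u ht_def)
      with min[of k] have "k \<notin> A" by auto
      with k have "ht q k \<le> ht p k" by (auto simp: A_def)
      with \<open>ht p k = ht p i - 1\<close> i_less ht_Suc_le[of q k] k show False
        by simp
    qed
    have notD: "t \<noteq> D"
    proof
      assume "t = D"
      then have "ht p (Suc i) = ht p i - 1"
        using vertex k by (auto simp: v ht_def)
      with min[of "Suc i"] have "Suc i \<notin> A" by auto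
      with k have "ht q (Suc i) \<le> ht p (Suc i)" by (auto simp: A_def)
      with \<open>ht p (Suc i) = ht p i - 1\<close> i_less ht_le_Suc[of q i] show False
        by simp
    qed
    \<comment> \<open>If \<open>q\<close> met \<open>p\<close> at the midpoint \<open>k\<close>,
      parity would make \<open>k\<close> a midpoint of an \<open>H\<close> of \<open>q\<close> too,
      and \<open>q\<close> would meet \<open>p\<close> at \<open>i\<close>.\<close>
    have k_in: "k \<in> A" if "s = H"
    proof (rule ccontr)
      assume "k \<notin> A"
      then have eq: "ht q k = ht p k" using le'[of k] k by (auto simp: A_def)
      have pk: "ht p k = ht p i" "k = Suc (length (incs u'))"
        using that vertex k by (auto simp: u ht_def)
      then have "odd (ht q k + int k)" using eq vertex(3) k by simp
      then have "ht q (Suc k) = ht q k"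
        using ht_odd_midpoint(2)[of "length (incs u')" q] pk k lq by simp
      with eq pk i_less k show False by simp
    qed
    have Suc_i_in: "Suc i \<in> A" if "t = H"
    proof (rule ccontr)
      assume "Suc i \<notin> A"
      then have eq: "ht q (Suc i) = ht p (Suc i)" using le'[of "Suc i"] k by (auto simp: A_def)
      have pk: "ht p (Suc i) = ht p i"
        using that vertex k by (auto simp: v ht_def)
      then have "odd (ht q (Suc i) + int (Suc i))" using eq vertex(3) by simp
      then have "ht q i = ht q (Suc i)"
        using ht_odd_midpoint(1)[of i q] k lq by simp
      with eq pk i_less k show False by simp
    qed
    show ?thesis
    proof (cases "s = H \<or> t = H")
      case True
      then show ?thesis
      proof
        assume "s = H"
        then show ?thesis
          using flip_mid[of u' v] k_in vertex k by (auto simp: u)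
      next
        assume "t = H"
        then show ?thesis
          using flip_mid[of u v'] Suc_i_in vertex k by (auto simp: v)
      qed
    next
      case False
      \<comment> \<open>Only a valley remains; flipping it raises the height at \<open>i\<close>
        itself.\<close>
      with notU notD have "s = D" "t = U" by (cases s; cases t; auto)+
      with vertex have "(p, u' @ H # v') = flip_pair (u', v', False)" "i = Suc (length (incs u'))"
        by (simp_all add: flip_pair_def u v)
      with flip_up[OF p le this(1)] i_less show ?thesis
        by auto
    qed
  qed
qed

text \<open>Between the ends of a cover there is a flip of the lower path, which must be the upper
  one. Conversely a flip changes one height by one, so any path in between has all heights of one of
  the two ends.\<close>

lemma hasse_edges_schroeder:
  "hasse_edges (schroeder n) (below n) = flip_pair ` marked_paths n"
proof -
  have *: "(p, q) \<in> hasse_edges (schroeder n) (below n) \<longleftrightarrow> 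
        p \<in> schroeder n \<and> q \<in> schroeder n \<and> (p, q) \<in> range flip_pair" for p q
  proof
    assume "(p, q) \<in> hasse_edges (schroeder n) (below n)"
    then have pq: "p \<in> schroeder n" "q \<in> schroeder n" "below n p q" "p \<noteq> q"
      and cover: "\<And>c. c \<in> schroeder n \<Longrightarrow> below n p c \<Longrightarrow> p \<noteq> c \<Longrightarrow> below n c q \<Longrightarrow> c = q"
      by (auto simp: hasse_edges_def)
    obtain p' where p': "p' \<in> schroeder n" "below n p' q" "(p, p') \<in> range flip_pair"
      using exists_flip_below[OF pq] by blast
    have "below n p p'" "p \<noteq> p'"
      using flip_pair_below[OF p'(3)] by metis+
    with cover p' pq show "p \<in> schroeder n \<and> q \<in> schroeder n \<and> (p, q) \<in> range flip_pair"
      by blast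
  next
    assume pq: "p \<in> schroeder n \<and> q \<in> schroeder n \<and> (p, q) \<in> range flip_pair"
    then have "(p, q) \<in> range flip_pair" by blast
    then obtain j where j: "\<And>i. ht q i = ht p i + (if i = j then 1 else 0)"
      and le: "below n p q" "p \<noteq> q"
      using flip_pair_below[of p q n] by metis
    have "c = p \<or> c = q" if c: "c \<in> schroeder n" "below n p c" "below n c q" for c
    proof (cases "ht c j = ht p j")
      case True
      have "below n c p"
        unfolding below_def
      proof (intro allI impI)
        fix i assume "i \<le> 2 * n"
        with True c(3) j[of i] show "ht c i \<le> ht p i"
          by (cases "i = j") (auto simp: below_def)
      qed
      with below_antisym[of c n p] c pq show ?thesis by simp
    next
      case False
      have "below n q c"
        unfolding below_def
      proof (intro allI impI)
        fix i assume i: "i \<le> 2 * n"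
        with c(2) have "ht p i \<le> ht c i" by (simp add: below_def)
        with False j[of i] show "ht q i \<le> ht c i"
          by (cases "i = j") auto
      qed
      with below_antisym[of c n q] c pq show ?thesis by simp
    qed
    with le show "(p, q) \<in> hasse_edges (schroeder n) (below n)"
      using pq by (auto simp: hasse_edges_def)
  qed
  have "x \<in> hasse_edges (schroeder n) (below n) \<longleftrightarrow> x \<in> flip_pair ` marked_paths n" for x
  proof (cases x)
    case (Pair p q)
    with *[of p q] show ?thesis
      by (simp only: flip_pair_marked_paths schroeder_eq_paths Int_iff mem_Sigma_iff conj_assoc)
  qed
  then show ?thesis by (rule set_eqI)
qed

lemma ellS_eq: "ellS n = (\<Sum>p\<in>paths 0 n. flips 0 p)"
proof -
  have "inj_on flip_pair (marked_paths n)"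
    using inj_flip_pair subset_UNIV by (rule inj_on_subset)
  then have "card (flip_pair ` marked_paths n) = card (marked_paths n)"
    by (rule card_image)
  then show ?thesis
    unfolding ellS_def ell_def hasse_edges_schroeder card_marked_paths .
qed

section \<open>Generating functions\<close>

unbundle no vec_syntax and fps_syntax

section \<open>Inverse square root, central binomial and Catalan series\<close>

definition inv_sqrt_fps :: "real \<Rightarrow> real fps" where
  "inv_sqrt_fps a = Abs_fps (\<lambda>n. a ^ n * (pochhammer (1/2) n / fact n))"

text \<open>The series is \<open>(1 - a x)^(-1/2)\<close>: substitute \<open>- a x\<close> into
  \<open>fps_binomial (-1/2)\<close>, whose square is \<open>1 / (1 + x)\<close> because the
  exponents add up.\<close>

lemma inv_sqrt_fps_square: "(inv_sqrt_fps a)\<^sup>2 * (1 - fps_const a * fps_X) = 1"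
proof -
  let ?y = "fps_const (-a) * fps_X :: real fps"
  have y0: "?y $ 0 = 0" by simp
  have eq: "inv_sqrt_fps a = fps_binomial (-1/2) oo ?y"
  proof (rule fps_ext)
    fix n
    have "(- a) ^ n = a ^ n * (- 1) ^ n"
      by (simp flip: power_mult_distrib)
    then show "inv_sqrt_fps a $ n = (fps_binomial (-1/2) oo ?y) $ n"
      by (simp add: inv_sqrt_fps_def gbinomial_pochhammer del: fps_const_neg)
  qed
  have "fps_binomial (-1/2) * fps_binomial (-1/2) = (inverse (1 + fps_X) :: real fps)"
    by (simp flip: fps_binomial_add_mult fps_binomial_minus_one)
  then have "fps_binomial (-1/2) * fps_binomial (-1/2) * (1 + fps_X) = (1 :: real fps)"
    by (simp add: inverse_mult_eq_1)
  then have "(fps_binomial (-1/2) * fps_binomial (-1/2) * (1 + fps_X)) oo ?y = 1"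
    by simp
  then have "(inv_sqrt_fps a)\<^sup>2 * (1 + ?y) = 1"
    by (simp add: fps_compose_mult_distrib[OF y0] fps_compose_add_distrib eq power2_eq_square
        del: fps_const_neg)
  then show ?thesis by (simp flip: fps_const_neg)
qed

definition central :: "real fps" where
  "central = Abs_fps (\<lambda>n. real ((2 * n) choose n))"

definition catalan :: "real fps" where
  "catalan = Abs_fps (\<lambda>n. real ((2 * n) choose n) / real (n + 1))"

lemma central_binomial_pochhammer:
  "real ((2 * n) choose n) = 4 ^ n * (pochhammer (1/2) n / fact n)"
proof -
  have "real ((2 * n) choose n) = fact (2 * n) / (fact n * fact n)"
    by (simp add: binomial_fact)
  also have "fact (2 * n) = (4::real) ^ n * pochhammer (1/2) n * fact n"
    by (simp add: fact_double power_mult)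
  finally show ?thesis by simp
qed

lemma central_square: "central\<^sup>2 * (1 - 4 * fps_X) = 1"
proof -
  have "central = inv_sqrt_fps 4"
    by (simp add: central_def inv_sqrt_fps_def central_binomial_pochhammer)
  then show ?thesis
    using inv_sqrt_fps_square[of 4] by (simp add: numeral_fps_const)
qed

lemma fps_eq_if_power2_eq:
  fixes f g :: "real fps"
  assumes "f\<^sup>2 = g\<^sup>2" "f $ 0 = 1" "g $ 0 = 1"
  shows "f = g"
proof -
  have "f = g \<or> f = - g" using assms(1) by (simp add: power2_eq_iff)
  moreover have "f \<noteq> - g" using assms(2,3) by (metis fps_neg_nth neg_equal_zero zero_neq_one)
  ultimately show ?thesis by blast
qed

text \<open>Both sides have constant term 1 and derivative \<open>- 2 * central\<close>. On the
  left, \<open>x\<close> times the Catalan series is an antiderivative of \<open>central\<close>; on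
  the right, differentiating \<open>central_square\<close> gives the differential equation
  needed.\<close>

lemma catalan_central: "1 - 2 * fps_X * catalan = (1 - 4 * fps_X) * central"
proof -
  have "fps_deriv (central ^ 2 * (1 - 4 * fps_X)) = 0"
    by (simp add: central_square)
  then have "2 * central * (fps_deriv central * (1 - 4 * fps_X) - 2 * central) = 0"
    by (simp add: power2_eq_square algebra_simps)
  moreover have "central $ 0 = 1" by (simp add: central_def)
  then have "central \<noteq> 0" by force
  ultimately have ode: "fps_deriv central * (1 - 4 * fps_X) = 2 * central"
    by simp
  have "fps_deriv (fps_X * catalan) = central"
    by (rule fps_ext) (simp add: central_def catalan_def divide_simps, simp add: algebra_simps)
  then have "fps_deriv (1 - 2 * (fps_X * catalan)) = - 2 * central"
    by (simp only: fps_deriv_sub fps_deriv_mult) simp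
  also have "- 2 * central = fps_deriv ((1 - 4 * fps_X) * central)"
    using ode by (simp add: algebra_simps)
  finally show ?thesis
    by (subst (asm) fps_deriv_eq_iff) (simp add: central_def mult.assoc)
qed

text \<open>The generating functions of the central Delannoy and of the large Schroeder numbers
  are \<open>central (z) / (1 - x)\<close> and \<open>catalan (z) / (1 - x)\<close> with \<open>z = x / (1 - x)\<^sup>2\<close>.\<close>

definition geom :: "real fps" where "geom = inverse (1 - fps_X)"
definition zeta :: "real fps" where "zeta = fps_X * geom ^ 2"
definition delannoy_fps :: "real fps" where "delannoy_fps = geom * (central oo zeta)"
definition schroeder_fps :: "real fps" where "schroeder_fps = geom * (catalan oo zeta)"

section \<open>Delannoy and Schroeder series by substitution of \<open>zeta\<close>\<close>

lemma geom_inverse: "geom * (1 - fps_X) = 1"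
  by (simp add: geom_def inverse_mult_eq_1)

lemma geom_power_nth: "(geom ^ m) $ j = multichoose m j"
proof -
  have "geom ^ m = inverse ((1 - fps_const 1 * fps_X) ^ m)"
    by (simp add: geom_def fps_inverse_power)
  also have "\<dots> = fps_binomial (- real m) oo (fps_const (-1) * fps_X)"
    by (subst one_minus_fps_X_const_neg_power) (simp add: fps_const_neg [symmetric] del: fps_const_neg)
  finally have "(geom ^ m) $ j = (-1) ^ j * (- real m gchoose j)"
    by (simp del: fps_const_neg)
  then show ?thesis
    by (simp add: multichoose_def gbinomial_pochhammer flip: power_mult_distrib)
qed

text \<open>Substituting \<open>zeta\<close> into \<open>central_square\<close> and
  \<open>catalan_central\<close> suffices, since
  \<open>(1 - x)^2 (1 - 4 zeta) = 1 - 6 x + x^2\<close>.\<close>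

lemma delannoy_fps_square: "delannoy_fps\<^sup>2 * (1 - 6 * fps_X + fps_X\<^sup>2) = 1"
  and schroeder_fps_delannoy_fps:
    "1 - fps_X - 2 * fps_X * schroeder_fps = (1 - 6 * fps_X + fps_X\<^sup>2) * delannoy_fps"
proof -
  have z0: "zeta $ 0 = 0" by (simp add: zeta_def)
  define b c where "b = central oo zeta" and "c = catalan oo zeta"
  have four: "(4 :: real fps) oo zeta = 4" and two: "(2 :: real fps) oo zeta = 2"
    by (simp_all add: numeral_fps_const)
  have "(central ^ 2 * (1 - 4 * fps_X)) oo zeta = 1" by (simp add: central_square)
  then have b: "b ^ 2 * (1 - 4 * zeta) = 1"
    by (simp add: fps_compose_mult_distrib[OF z0] fps_compose_power[OF z0, symmetric]
        fps_compose_sub_distrib b_def four z0)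
  have "(1 - 2 * fps_X * catalan) oo zeta = ((1 - 4 * fps_X) * central) oo zeta"
    by (simp add: catalan_central)
  then have c: "1 - 2 * zeta * c = (1 - 4 * zeta) * b"
    by (simp add: fps_compose_mult_distrib[OF z0] fps_compose_sub_distrib b_def c_def four two z0)
  have d: "delannoy_fps = geom * b" "schroeder_fps = geom * c" "zeta = fps_X * geom ^ 2"
    by (simp_all add: delannoy_fps_def schroeder_fps_def b_def c_def zeta_def)
  have zeta: "(1 - fps_X) * zeta = fps_X * geom"
    using geom_inverse d(3) by algebra
  have zeta': "(1 - fps_X) * (1 - fps_X) * (1 - 4 * zeta) = 1 - 6 * fps_X + fps_X\<^sup>2"
    using geom_inverse d(3) by algebra
  show "delannoy_fps\<^sup>2 * (1 - 6 * fps_X + fps_X\<^sup>2) = 1"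
    unfolding d(1) zeta'[symmetric] using geom_inverse b by algebra
  have "1 - fps_X - 2 * fps_X * schroeder_fps = (1 - fps_X) * (1 - 2 * zeta * c)"
    unfolding d(2) using zeta by algebra
  also have "\<dots> = (1 - fps_X) * (1 - 4 * zeta) * b" by (simp add: c)
  also have "\<dots> = (1 - 6 * fps_X + fps_X\<^sup>2) * delannoy_fps"
    unfolding d(1) zeta'[symmetric] using geom_inverse by algebra
  finally show "1 - fps_X - 2 * fps_X * schroeder_fps = (1 - 6 * fps_X + fps_X\<^sup>2) * delannoy_fps" .
qed

lemma schroeder_delannoy_inverse: "(1 - fps_X - 2 * fps_X * schroeder_fps) * delannoy_fps = 1"
  unfolding schroeder_fps_delannoy_fps using delannoy_fps_square
  by (simp add: power2_eq_square mult_ac)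

text \<open>The square of \<open>1 - x - 2 x R\<close> is \<open>1 - 6 x + x^2\<close>; expanding
  and cancelling \<open>4 x\<close> leaves the quadratic equation.\<close>

lemma schroeder_fps_eq: "schroeder_fps = 1 + fps_X * schroeder_fps + fps_X * schroeder_fps\<^sup>2"
proof -
  have "(1 - fps_X - 2 * fps_X * schroeder_fps)\<^sup>2 = 1 - 6 * fps_X + fps_X\<^sup>2"
    using schroeder_delannoy_inverse schroeder_fps_delannoy_fps by algebra
  then have "4 * fps_X * (schroeder_fps - (1 + fps_X * schroeder_fps + fps_X * schroeder_fps\<^sup>2)) = 0"
    by algebra
  then show ?thesis by simp
qed

text \<open>The series \<open>zeta ^ k\<close> starts at \<open>x^k\<close>, so every inner sum can
  be extended to all \<open>k \<le> n\<close> before the sums are exchanged.\<close>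

lemma geom_compose_nth: "(geom * (f oo zeta)) $ n = (\<Sum>k\<le>n. f $ k * (geom * zeta ^ k) $ n)"
proof -
  have zk: "zeta ^ k $ j = 0" if "j < k" for k j
    using that by (simp add: zeta_def power_mult_distrib fps_X_power_mult_nth)
  have "(geom * (f oo zeta)) $ n = (\<Sum>i\<le>n. geom $ i * (\<Sum>k=0..n-i. f $ k * zeta ^ k $ (n - i)))"
    by (simp add: fps_mult_nth fps_compose_nth atMost_atLeast0)
  also have "\<dots> = (\<Sum>i\<le>n. geom $ i * (\<Sum>k\<le>n. f $ k * zeta ^ k $ (n - i)))"
    by (intro sum.cong refl arg_cong2[where f = "(*)"] sum.mono_neutral_left) (auto simp: zk)
  also have "\<dots> = (\<Sum>k\<le>n. \<Sum>i\<le>n. f $ k * (geom $ i * zeta ^ k $ (n - i)))"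
    by (subst sum.swap) (simp add: sum_distrib_left mult_ac)
  also have "\<dots> = (\<Sum>k\<le>n. f $ k * (geom * zeta ^ k) $ n)"
    by (simp add: fps_mult_nth sum_distrib_left atMost_atLeast0)
  finally show ?thesis .
qed

lemma zeta_power_nth: "zeta ^ k $ n = (if n < k then 0 else multichoose (2 * k) (n - k))"
  by (simp add: zeta_def power_mult_distrib fps_X_power_mult_nth geom_power_nth flip: power_mult)

lemma multichoose_eq_choose: "multichoose (Suc m) j = real ((m + j) choose j)"
proof -
  have "real ((m + j) choose j) = real (m + j) gchoose j"
    by (simp add: binomial_gbinomial)
  also have "\<dots> = multichoose (Suc m) j"
    by (subst gbinomial_pochhammer') (simp add: multichoose_def add.commute)
  finally show ?thesis ..
qed

text \<open>The summands agree one by one: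
  \<open>C(2k,k) C(n+k,n-k) = C(n,k) C(n+k,k)\<close>.\<close>

lemma delannoy_fps_nth: "delannoy_fps $ n = real (delannoy n)"
proof -
  have "central $ k * (geom * zeta ^ k) $ n = real ((n choose k) * ((n + k) choose k))" if "k \<le> n" for k
  proof -
    have "geom * zeta ^ k = fps_X ^ k * geom ^ (Suc (2 * k))"
      by (simp add: zeta_def power_mult_distrib mult_ac flip: power_mult)
    then have "(geom * zeta ^ k) $ n = real ((2 * k + (n - k)) choose (n - k))"
      using that by (simp only: fps_X_power_mult_nth geom_power_nth multichoose_eq_choose) simp
    also have "2 * k + (n - k) = n + k" using that by simp
    also have "real ((n + k) choose (n - k)) = fact (n + k) / (fact (n - k) * fact (2 * k))"
      using that by (simp add: binomial_fact mult_2)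
    also have "central $ k * \<dots> = fact (n + k) / (fact (n - k) * (fact k * fact k))"
      by (simp add: central_def binomial_fact)
    also have "\<dots> = real ((n choose k) * ((n + k) choose k))"
      using that by (simp add: binomial_fact)
    finally show ?thesis .
  qed
  then show ?thesis
    unfolding delannoy_fps_def geom_compose_nth delannoy_def of_nat_sum
    by (intro sum.cong) auto
qed

text \<open>Removing the first step of a path expresses the number of paths with given \<open>(h, n)\<close> through
  those for smaller \<open>n\<close>, or equal \<open>n\<close> and smaller \<open>h\<close>, so it suffices that the powers of
  \<open>schroeder_fps\<close> obey the same recursion.\<close>
lemma card_paths: "real (card (paths h n)) = (schroeder_fps ^ Suc h) $ n"
proof (induction n arbitrary: h)
  case 0
  have c: "real (card (paths h 0)) = (if h = 0 then 1 else real (card (paths (h - 1) 0)))" for h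
    using sum_paths_rec[of "\<lambda>_. 1 :: real" h 0] by simp
  have "schroeder_fps $ 0 = 1"
    by (subst schroeder_fps_eq) simp
  then show ?case
    by (induction h) (subst c; simp)+
next
  case (Suc n)
  note IH = Suc
  have c: "real (card (paths h (Suc n))) = (schroeder_fps ^ Suc (Suc h)) $ n + (schroeder_fps ^ Suc h) $ n
      + (if h = 0 then 0 else real (card (paths (h - 1) (Suc n))))" for h
    using sum_paths_rec[of "\<lambda>_. 1 :: real" h "Suc n"] by (simp add: IH del: power_Suc)
  have "schroeder_fps ^ Suc h = fps_X * schroeder_fps ^ Suc (Suc h) + fps_X * schroeder_fps ^ Suc h
      + schroeder_fps ^ h" for h
    using arg_cong[OF schroeder_fps_eq, of "\<lambda>f. f * schroeder_fps ^ h"]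
    by (simp add: algebra_simps power2_eq_square)
  from arg_cong[OF this, of "\<lambda>f. f $ Suc n"]
  have r: "(schroeder_fps ^ Suc h) $ (Suc n) = (schroeder_fps ^ Suc (Suc h)) $ n + (schroeder_fps ^ Suc h) $ n
      + (schroeder_fps ^ h) $ Suc n" for h
    by (simp del: power_Suc)
  show ?case
  proof (induction h)
    case 0
    show ?case by (subst c, subst r) simp
  next
    case (Suc h)
    show ?case by (subst c, subst r) (simp add: Suc del: power_Suc)
  qed
qed

lemma schr_eq: "real (schr n) = schroeder_fps $ n"
  using card_paths[of 0 n] by (simp add: schr_def schroeder_eq_paths)

text \<open>In \<open>R^(h+1)\<close>, marking an \<open>H\<close> turns one of the
  \<open>h + 1\<close> factors \<open>R\<close> into \<open>x R D\<close>; the first term counts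
  each mark twice. An \<open>H\<close> on the axis splits the path into a path from height
  \<open>h\<close> and a Schroeder path, so \<open>x R^(h+2)\<close> removes its second
  count.\<close>

definition flips_fps :: "nat \<Rightarrow> real fps" where
  "flips_fps h = 2 * of_nat (Suc h) * fps_X * schroeder_fps ^ Suc h * delannoy_fps
     - fps_X * schroeder_fps ^ (h + 2)"

lemma flips_fps_0:
  "flips_fps 0 = fps_X * flips_fps 1 + fps_X * (flips_fps 0 + schroeder_fps)"
  using schroeder_fps_eq schroeder_delannoy_inverse unfolding flips_fps_def
  by simp algebra

lemma flips_fps_Suc:
  "flips_fps (Suc h) = fps_X * flips_fps (Suc (Suc h))
     + fps_X * (flips_fps (Suc h) + 2 * schroeder_fps ^ (h + 2)) + flips_fps h"
proof -
  define k :: "real fps" where "k = of_nat h"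
  define X R D where "X = (fps_X :: real fps)" and "R = schroeder_fps" and "D = delannoy_fps"
  have R: "R - X * R\<^sup>2 - X * R - 1 = 0"
    using schroeder_fps_eq by (simp add: R_def X_def algebra_simps)
  \<comment> \<open>Multiplied by \<open>D\<close>, this turns the inverse relation
    \<open>(1 - x - 2 x R) D = 1\<close> into \<open>D (1 - x R^2) = R\<close>.\<close>
  have "1 - X * R\<^sup>2 = R * (1 - X - 2 * X * R)"
    using R by algebra
  then have D: "D * (1 - X * R\<^sup>2) - R = 0"
    using schroeder_delannoy_inverse by (simp add: R_def X_def D_def mult_ac)
  \<comment> \<open>With the common factor \<open>R ^ h\<close> removed, the claim is a polynomial
    identity modulo the two relations \<open>R\<close> and \<open>D\<close>.\<close>
  define A0 A1 A2 where "A0 = 2 * (k + 1) * X * R * D - X * R\<^sup>2"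
    and "A1 = 2 * (k + 2) * X * R\<^sup>2 * D - X * R ^ 3"
    and "A2 = 2 * (k + 3) * X * R ^ 3 * D - X * R ^ 4"
  have "A1 - (X * A2 + X * (A1 + 2 * R\<^sup>2) + A0) = 2 * X * R * D * (k + 2) * (R - X * R\<^sup>2 - X * R - 1)
      + 2 * X * R * (D * (1 - X * R\<^sup>2) - R) - X * R\<^sup>2 * (R - X * R\<^sup>2 - X * R - 1)"
    unfolding A0_def A1_def A2_def by algebra
  then have "A1 = X * A2 + X * (A1 + 2 * R\<^sup>2) + A0"
    unfolding R D by simp
  then have "R ^ h * A1 = X * (R ^ h * A2) + X * (R ^ h * A1 + 2 * (R ^ h * R\<^sup>2)) + R ^ h * A0"
    by (metis (no_types, opaque_lifting) distrib_left mult.left_commute)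
  moreover have "flips_fps h = R ^ h * A0" "flips_fps (Suc h) = R ^ h * A1"
    "flips_fps (Suc (Suc h)) = R ^ h * A2" "schroeder_fps ^ (h + 2) = R ^ h * R\<^sup>2"
    by (simp_all add: flips_fps_def k_def A0_def A1_def A2_def R_def X_def D_def
        algebra_simps power_add eval_nat_numeral)
  ultimately show ?thesis by (simp add: X_def)
qed

text \<open>The double induction is that of \<open>card_paths\<close>. A leading \<open>H\<close>
  adds one per continuation on the axis and two above it, and \<open>card_paths\<close> counts the
  continuations.\<close>

lemma sum_flips: "real (\<Sum>p\<in>paths h n. flips h p) = flips_fps h $ n"
  unfolding of_nat_sum
proof (induction n arbitrary: h)
  case 0
  have c: "(\<Sum>p\<in>paths h 0. real (flips h p)) = (if h = 0 then 0 else \<Sum>p\<in>paths (h - 1) 0. real (flips (h - 1) p))" for h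
    using sum_paths_rec[of "\<lambda>p. real (flips h p)" h 0] by simp
  have "flips_fps h $ 0 = 0"
    by (simp add: flips_fps_def mult.assoc mult.left_commute[of _ fps_X])
  moreover have "(\<Sum>p\<in>paths h 0. real (flips h p)) = 0"
    by (induction h) (subst c; simp)+
  ultimately show ?case by simp
next
  case (Suc n)
  note IH = Suc
  have c: "(\<Sum>p\<in>paths h (Suc n). real (flips h p)) = flips_fps (Suc h) $ n
     + ((if h = 0 then 1 else 2) * (schroeder_fps ^ Suc h) $ n + flips_fps h $ n)
     + (if h = 0 then 0 else \<Sum>p\<in>paths (h - 1) (Suc n). real (flips (h - 1) p))" for h
    using sum_paths_rec[of "\<lambda>p. real (flips h p)" h "Suc n"]
    by (simp add: IH sum.distrib card_paths del: power_Suc)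
  show ?case
  proof (induction h)
    case 0
    show ?case by (subst c, subst flips_fps_0) simp
  next
    case (Suc h)
    have "(2 * schroeder_fps ^ (h + 2)) $ n = 2 * schroeder_fps ^ (h + 2) $ n"
      by (simp add: numeral_fps_const)
    then show ?case by (subst c, subst flips_fps_Suc) (simp add: Suc)
  qed
qed

section \<open>The edge series and its coefficients\<close>

definition ell_fps :: "real fps" where
  "ell_fps = (1 - fps_X) * (delannoy_fps - schroeder_fps)"

lemma ellS_nth: "real (ellS n) = ell_fps $ n"
proof -
  have "flips_fps 0 = ell_fps"
    using schroeder_fps_eq schroeder_delannoy_inverse unfolding flips_fps_def ell_fps_def
    by simp algebra
  then show ?thesis
    using sum_flips[of 0 n] by (simp add: ellS_eq)
qed

lemma ellS_Suc:
  "real (ellS (Suc n)) = real (delannoy (Suc n)) - real (schr (Suc n)) - real (delannoy n) + real (schr n)"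
  by (simp add: ellS_nth ell_fps_def delannoy_fps_nth schr_eq left_diff_distrib)

text \<open>The factor \<open>1 - x\<close> cancels \<open>geom\<close>, leaving
  \<open>central - catalan\<close> at \<open>zeta\<close>; its coefficients before substitution are
  \<open>C(2k,k) k / (k+1)\<close>.\<close>

lemma ellS_eq_sum:
  "real (ellS n) = (\<Sum>k = 0..n. multichoose (2 * k) (n - k) * real ((2 * k) choose k) * real k / real (k + 1))"
proof -
  have "ell_fps = (central - catalan) oo zeta"
    unfolding ell_fps_def delannoy_fps_def schroeder_fps_def fps_compose_sub_distrib
    using geom_inverse by algebra
  then have "real (ellS n) = ((central - catalan) oo zeta) $ n"
    by (simp only: ellS_nth)
  also have "\<dots> = (\<Sum>k=0..n. (central $ k - catalan $ k) * multichoose (2 * k) (n - k))"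
    unfolding fps_compose_nth by (intro sum.cong) (auto simp: zeta_power_nth)
  also have "\<dots> = (\<Sum>k = 0..n. multichoose (2 * k) (n - k) * real ((2 * k) choose k) * real k / real (k + 1))"
    by (intro sum.cong refl) (simp add: central_def catalan_def divide_simps, simp add: algebra_simps)
  finally show ?thesis .
qed

section \<open>Convergence and asymptotics\<close>

lemma sums_inv_sqrt_fps:
  assumes "\<bar>a * x\<bar> < 1"
  shows "(\<lambda>n. inv_sqrt_fps a $ n * x ^ n) sums (1 / sqrt (1 - a * x))"
    and "summable (\<lambda>n. \<bar>inv_sqrt_fps a $ n * x ^ n\<bar>)"
proof -
  have *: "(\<lambda>n. inv_sqrt_fps a $ n * x ^ n) sums (1 / sqrt (1 - a * x))" if "\<bar>a * x\<bar> < 1" for a x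
  proof -
    have "(\<lambda>n. (- (1/2) gchoose n) * (- (a * x)) ^ n) sums (1 + - (a * x)) powr (- (1/2))"
      by (rule gen_binomial_real) (use that in simp)
    moreover have "(- (1/2) gchoose n) * (- (a * x)) ^ n = inv_sqrt_fps a $ n * x ^ n" for n
    proof -
      have "(- (a * x)) ^ n = (- 1) ^ n * (a ^ n * x ^ n)"
        by (simp flip: power_mult_distrib)
      then show ?thesis
        by (simp add: gbinomial_pochhammer inv_sqrt_fps_def)
    qed
    moreover have "(1 + - (a * x)) powr (- (1/2)) = 1 / sqrt (1 - a * x)"
      using that by (simp add: powr_minus powr_half_sqrt inverse_eq_divide)
    ultimately show ?thesis by simp
  qed
  show "(\<lambda>n. inv_sqrt_fps a $ n * x ^ n) sums (1 / sqrt (1 - a * x))"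
    by (rule *[OF assms])
  \<comment> \<open>The coefficients are nonnegative for \<open>a \<ge> 0\<close>, so the absolute
    values form the same series at \<open>|a|\<close> and \<open>|x|\<close>.\<close>
  have "\<bar>\<bar>a\<bar> * \<bar>x\<bar>\<bar> < 1" using assms by (simp add: abs_mult)
  from sums_summable[OF *[OF this]] show "summable (\<lambda>n. \<bar>inv_sqrt_fps a $ n * x ^ n\<bar>)"
    by (simp add: inv_sqrt_fps_def abs_mult power_abs pochhammer_nonneg)
qed

text \<open>\<open>alpha\<close> and \<open>beta\<close> are the roots of
  \<open>1 - 6 x + x^2\<close>. As their product is 1, \<open>beta\<close> is the radius
  \<open>1 / alpha\<close> and \<open>alpha\<close> the growth rate.\<close>

definition alpha :: real where "alpha = 3 + 2 * sqrt 2"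
definition beta :: real where "beta = 3 - 2 * sqrt 2"

lemma alpha_beta: "alpha * beta = 1" "alpha + beta = 6"
  by (simp_all add: alpha_def beta_def algebra_simps)

lemma alpha_beta_bounds: "0 < beta" "beta < 1" "1 < alpha"
proof -
  have "sqrt 2 < 3 / 2"
    by (rule real_less_lsqrt) (simp_all add: power2_eq_square)
  moreover have "1 < sqrt 2" by simp
  ultimately show "0 < beta" "beta < 1" "1 < alpha"
    unfolding alpha_def beta_def by linarith+
qed

lemma delannoy_fps_eq: "delannoy_fps = inv_sqrt_fps alpha * inv_sqrt_fps beta"
proof (rule fps_eq_if_power2_eq)
  define a b where "a = fps_const alpha" and "b = fps_const beta"
  have ab: "a * b = 1" "a + b = 6"
    using alpha_beta by (simp_all add: a_def b_def numeral_fps_const)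
  have "(inv_sqrt_fps alpha)\<^sup>2 * (1 - a * fps_X) = 1" "(inv_sqrt_fps beta)\<^sup>2 * (1 - b * fps_X) = 1"
    using inv_sqrt_fps_square by (simp_all add: a_def b_def)
  with ab have "(inv_sqrt_fps alpha * inv_sqrt_fps beta)\<^sup>2 * (1 - 6 * fps_X + fps_X\<^sup>2) = 1"
    by algebra
  with delannoy_fps_square show "delannoy_fps\<^sup>2 = (inv_sqrt_fps alpha * inv_sqrt_fps beta)\<^sup>2"
    by algebra
qed (simp_all add: delannoy_fps_nth delannoy_def inv_sqrt_fps_def)

lemma sums_delannoy:
  assumes "\<bar>x\<bar> < beta"
  shows "(\<lambda>n. delannoy_fps $ n * x ^ n) sums (1 / sqrt (1 - 6 * x + x\<^sup>2))"
proof -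
  have "alpha * \<bar>x\<bar> < alpha * beta"
    using assms alpha_beta_bounds by simp
  then have a: "\<bar>alpha * x\<bar> < 1"
    using alpha_beta alpha_beta_bounds by (simp add: abs_mult)
  have "beta * \<bar>x\<bar> < 1 * 1"
    using assms alpha_beta_bounds by (intro mult_strict_mono) auto
  then have b: "\<bar>beta * x\<bar> < 1"
    using alpha_beta_bounds by (simp add: abs_mult)
  note A = sums_inv_sqrt_fps[OF a] and B = sums_inv_sqrt_fps[OF b]
  have "(\<lambda>n. \<Sum>i\<le>n. (inv_sqrt_fps alpha $ i * x ^ i) * (inv_sqrt_fps beta $ (n - i) * x ^ (n - i)))
      sums ((1 / sqrt (1 - alpha * x)) * (1 / sqrt (1 - beta * x)))"
    using Cauchy_product_sums[OF A(2)[folded real_norm_def] B(2)[folded real_norm_def]]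
      sums_unique[OF A(1)] sums_unique[OF B(1)] by simp
  moreover have "(\<Sum>i\<le>n. (inv_sqrt_fps alpha $ i * x ^ i) * (inv_sqrt_fps beta $ (n - i) * x ^ (n - i)))
      = delannoy_fps $ n * x ^ n" for n
  proof -
    have "(inv_sqrt_fps alpha $ i * x ^ i) * (inv_sqrt_fps beta $ (n - i) * x ^ (n - i))
       = inv_sqrt_fps alpha $ i * inv_sqrt_fps beta $ (n - i) * x ^ n" if "i \<le> n" for i
      using power_add[of x i "n - i"] that by simp
    then show ?thesis
      unfolding delannoy_fps_eq fps_mult_nth sum_distrib_right atMost_atLeast0
      by (intro sum.cong refl) simp
  qed
  moreover have "(1 - alpha * x) * (1 - beta * x) = 1 - 6 * x + x\<^sup>2"
    using alpha_beta by algebra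
  then have "(1 / sqrt (1 - alpha * x)) * (1 / sqrt (1 - beta * x)) = 1 / sqrt (1 - 6 * x + x\<^sup>2)"
    by (simp flip: real_sqrt_mult)
  ultimately show ?thesis by simp
qed

lemma sums_fps_X_mult:
  fixes F :: "real fps"
  assumes "(\<lambda>n. F $ n * x ^ n) sums s"
  shows "(\<lambda>n. (fps_X * F) $ n * x ^ n) sums (x * s)"
proof -
  have "(\<lambda>n. (fps_X * F) $ Suc n * x ^ Suc n) sums (x * s)"
    using sums_mult[OF assms, of x] by (simp add: mult_ac)
  from sums_Suc[OF this] show ?thesis by simp
qed

text \<open>Eliminating \<open>schroeder_fps\<close> reduces convergence of the edge series to that
  of the Delannoy series.\<close>

lemma ell_fps_delannoy_fps:
  "2 * (fps_X * ell_fps) = (1 - fps_X) * ((1 - 4 * fps_X + fps_X\<^sup>2) * delannoy_fps - (1 - fps_X))"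
  using schroeder_fps_delannoy_fps unfolding ell_fps_def by algebra

lemma sums_ellS:
  assumes "x \<noteq> 0" "\<bar>x\<bar> < beta"
  shows "(\<lambda>n. real (ellS n) * x ^ n) sums
    ((1 - x) * (1 - 4 * x + x\<^sup>2 - (1 - x) * sqrt (1 - 6 * x + x\<^sup>2)) / (2 * x * sqrt (1 - 6 * x + x\<^sup>2)))"
proof -
  define S where "S = sqrt (1 - 6 * x + x\<^sup>2)"
  have "(1 - alpha * x) * (1 - beta * x) = 1 - 6 * x + x\<^sup>2"
    using alpha_beta by algebra
  moreover have "alpha * x < 1"
  proof -
    have "alpha * x \<le> alpha * \<bar>x\<bar>" "alpha * \<bar>x\<bar> < alpha * beta"
      using assms alpha_beta_bounds by (simp_all add: mult_left_mono)
    then show ?thesis using alpha_beta by simp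
  qed
  moreover have "beta * x < 1"
  proof -
    have "beta * x \<le> beta * \<bar>x\<bar>"
      using alpha_beta_bounds by (simp add: mult_left_mono)
    moreover have "beta * \<bar>x\<bar> < 1 * 1"
      using assms alpha_beta_bounds by (intro mult_strict_mono) auto
    ultimately show ?thesis by simp
  qed
  \<comment> \<open>Both linear factors are positive, so the square root in the denominator does not
    vanish.\<close>
  ultimately have "0 < 1 - 6 * x + x\<^sup>2"
    by (metis diff_gt_0_iff_gt mult_pos_pos)
  then have S: "S \<noteq> 0" by (simp add: S_def)
  define P where "P = (1 - 4 * fps_X + fps_X\<^sup>2) * delannoy_fps - (1 - fps_X)"
  note D = sums_delannoy[OF assms(2), folded S_def]
  note XD = sums_fps_X_mult[OF D]
  have one: "(\<lambda>n. (1 :: real fps) $ n * x ^ n) sums 1"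
    using sums_single[of 0 "\<lambda>_. 1 :: real"] by (simp add: if_distrib if_distribR cong: if_cong)
  have "(\<lambda>n. P $ n * x ^ n) sums (1 / S - 4 * (x * (1 / S)) + x * (x * (1 / S)) - (1 - x * 1))"
  proof -
    have P: "P = delannoy_fps - fps_const 4 * (fps_X * delannoy_fps) + fps_X * (fps_X * delannoy_fps)
        - (1 - fps_X * 1)"
      unfolding P_def by (simp add: algebra_simps power2_eq_square numeral_fps_const)
    have "P $ n * x ^ n = delannoy_fps $ n * x ^ n - 4 * ((fps_X * delannoy_fps) $ n * x ^ n)
        + (fps_X * (fps_X * delannoy_fps)) $ n * x ^ n
        - ((1 :: real fps) $ n * x ^ n - (fps_X * 1 :: real fps) $ n * x ^ n)" for n
      unfolding P fps_sub_nth fps_add_nth fps_mult_left_const_nth by (simp only: algebra_simps)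
    then show ?thesis
      by (simp only:) (intro sums_add sums_diff sums_mult D XD sums_fps_X_mult one)
  qed
  from sums_diff[OF this sums_fps_X_mult[OF this]]
  have "(\<lambda>n. (P - fps_X * P) $ n * x ^ n) sums
     ((1 - x) * (1 / S - 4 * (x * (1 / S)) + x * (x * (1 / S)) - (1 - x)))"
    by (simp only: fps_sub_nth left_diff_distrib mult_1 mult_1_right)
  moreover have "P - fps_X * P = fps_const 2 * (fps_X * ell_fps)"
    using ell_fps_delannoy_fps by (simp add: P_def left_diff_distrib numeral_fps_const)
  ultimately have "(\<lambda>n. 2 * ((fps_X * ell_fps) $ n * x ^ n)) sums
     ((1 - x) * (1 / S - 4 * (x * (1 / S)) + x * (x * (1 / S)) - (1 - x)))"
    by (simp only: fps_mult_left_const_nth mult.assoc)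
  from sums_mult[OF this, of "1 / (2 * x)"]
  have "(\<lambda>n. (1 / (2 * x)) * (2 * ((fps_X * ell_fps) $ n * x ^ n))) sums
     ((1 - x) * (1 - 4 * x + x\<^sup>2 - (1 - x) * S) / (2 * x * S))"
    using S assms(1) by (simp add: field_simps power2_eq_square)
  \<comment> \<open>The term at index 0 vanishes because of the factor \<open>fps_X\<close>, so the
    series may start at 1.\<close>
  then have "(\<lambda>n. (1 / (2 * x)) * (2 * ((fps_X * ell_fps) $ Suc n * x ^ Suc n))) sums
     ((1 - x) * (1 - 4 * x + x\<^sup>2 - (1 - x) * S) / (2 * x * S))"
    by (subst sums_Suc_iff) simp
  then show ?thesis
    using assms(1) by (simp add: S_def ellS_nth)
qed

section \<open>Growth of the central Delannoy and large Schroeder numbers\<close>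

definition cb :: "nat \<Rightarrow> real" where "cb n = pochhammer (1/2) n / fact n"

lemma cb_nonneg: "0 \<le> cb n"
  by (simp add: cb_def pochhammer_nonneg)

text \<open>\<open>cb n\<close> is \<open>C(2n,n) / 4^n\<close>. The left side decreases since
  \<open>(2n+1)^2 (n+2) \<le> (2n+2)^2 (n+1)\<close>. The bound provides the domination in
  \<open>delannoy_asymp\<close>.\<close>

lemma cb_square_le: "(cb n)\<^sup>2 * real (Suc n) \<le> 1"
proof (induction n)
  case 0
  then show ?case by (simp add: cb_def)
next
  case (Suc n)
  have "cb (Suc n) = cb n * ((2 * real n + 1) / (2 * real n + 2))"
    by (simp add: cb_def pochhammer_rec' field_simps)
  then have "(cb (Suc n))\<^sup>2 * real (Suc (Suc n)) =
     (cb n)\<^sup>2 * ((2 * real n + 1)\<^sup>2 * (real n + 2) / (2 * real n + 2)\<^sup>2)"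
    by (simp add: power_mult_distrib power_divide add.commute)
  also have "\<dots> = ((cb n)\<^sup>2 * real (Suc n)) *
      ((2 * real n + 1)\<^sup>2 * (real n + 2) / ((2 * real n + 2)\<^sup>2 * real (Suc n)))"
    by (simp del: of_nat_Suc)
  also have "\<dots> \<le> 1 * 1"
  proof (rule mult_mono[OF Suc])
    show "(2 * real n + 1)\<^sup>2 * (real n + 2) / ((2 * real n + 2)\<^sup>2 * real (Suc n)) \<le> 1"
    proof (subst divide_le_eq_1_pos)
      show "0 < (2 * real n + 2)\<^sup>2 * real (Suc n)"
        by (intro mult_pos_pos zero_less_power) auto
    qed (simp add: power2_eq_square algebra_simps)
  qed auto
  finally show ?case by simp
qed

lemma cb_le_1: "cb n \<le> 1"
proof -
  have "(cb n)\<^sup>2 * 1 \<le> (cb n)\<^sup>2 * real (Suc n)"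
    by (intro mult_left_mono) auto
  with cb_square_le[of n] have "(cb n)\<^sup>2 \<le> 1\<^sup>2" by simp
  then show ?thesis
    by (rule power2_le_imp_le) simp
qed

text \<open>For \<open>n > 0\<close> the quantity is the reciprocal of
  \<open>Gamma_series' (1/2) n\<close>, which tends to \<open>Gamma (1/2) = sqrt pi\<close>.\<close>

lemma cb_asymp: "(\<lambda>n. cb n * sqrt (real n)) \<longlonglongrightarrow> 1 / sqrt pi"
proof -
  have "(\<lambda>n. 1 / Gamma_series' (1/2) n) \<longlonglongrightarrow> 1 / (sqrt pi :: real)"
    using Gamma_series'_LIMSEQ[of "1/2 :: real"]
    by (intro tendsto_intros) (simp_all add: Gamma_one_half_real)
  moreover have "eventually (\<lambda>n. 1 / Gamma_series' (1/2) n = cb n * sqrt (real n)) sequentially"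
    using eventually_gt_at_top[of 0]
  proof eventually_elim
    case (elim n)
    have "exp (ln (real n) / 2) = sqrt (real n)"
      using elim by (simp add: ln_sqrt[symmetric])
    moreover have "real n = sqrt (real n) * sqrt (real n)" by simp
    moreover have "fact n = real n * fact (n - 1)" using elim by (simp add: fact_reduce)
    ultimately show ?case
      using elim by (simp add: Gamma_series'_def cb_def field_simps)
  qed
  ultimately show ?thesis by (rule Lim_transform_eventually)
qed

lemma cb_asymp_shift: "(\<lambda>n. cb (n - k) * sqrt (real n)) \<longlonglongrightarrow> 1 / sqrt pi"
proof (rule LIMSEQ_offset)
  have "(\<lambda>n. sqrt (real (n + k) / real n)) \<longlonglongrightarrow> 1"
    by real_asymp
  from tendsto_mult[OF cb_asymp this]
  have "(\<lambda>n. cb n * sqrt (real n) * sqrt (real (n + k) / real n)) \<longlonglongrightarrow> 1 / sqrt pi"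
    by simp
  moreover have "eventually (\<lambda>n. cb n * sqrt (real n) * sqrt (real (n + k) / real n)
       = cb (n + k - k) * sqrt (real (n + k))) sequentially"
    using eventually_gt_at_top[of 0]
    by eventually_elim (simp add: real_sqrt_divide)
  ultimately show "(\<lambda>n. cb (n + k - k) * sqrt (real (n + k))) \<longlonglongrightarrow> 1 / sqrt pi"
    by (rule Lim_transform_eventually)
qed

definition nu :: "nat \<Rightarrow> real" where "nu n = sqrt (real n) / alpha ^ n"
text \<open>The factor \<open>(1 - beta x)^(-1/2)\<close> at the dominant singularity
  \<open>x = beta\<close>, times the constant \<open>1 / sqrt pi\<close> of
  \<open>cb_asymp\<close>.\<close>

definition kappa :: real where "kappa = 1 / (sqrt pi * sqrt (1 - beta\<^sup>2))"

text \<open>Tannery's theorem applied to the convolution of the two inverse square roots whose product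
  is the generating function of the central Delannoy numbers.\<close>
lemma delannoy_asymp: "(\<lambda>n. real (delannoy n) * nu n) \<longlonglongrightarrow> kappa"
proof -
  \<comment> \<open>Since \<open>alpha * beta = 1\<close>, the quotient
    \<open>beta^k alpha^(n-k) / alpha^n\<close> is \<open>(beta^2)^k\<close>.\<close>
  define a where "a k n = (if k \<le> n then (cb k * (beta\<^sup>2) ^ k) * (cb (n - k) * sqrt (real n)) else 0)" for k n
  define b where "b k = (cb k * (beta\<^sup>2) ^ k) * (1 / sqrt pi)" for k
  have q: "beta\<^sup>2 < 1" "\<bar>beta\<^sup>2\<bar> < 1"
    using alpha_beta_bounds by (simp_all add: abs_square_less_1)
  have "(\<lambda>n. suminf (\<lambda>k. a k n)) \<longlonglongrightarrow> suminf b"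
  proof (rule tannerys_theorem[THEN conjunct2, THEN conjunct2])
    fix k
    have "(\<lambda>n. (cb k * (beta\<^sup>2) ^ k) * (cb (n - k) * sqrt (real n))) \<longlonglongrightarrow> b k"
      unfolding b_def by (intro tendsto_mult_left cb_asymp_shift)
    moreover have "eventually (\<lambda>n. (cb k * (beta\<^sup>2) ^ k) * (cb (n - k) * sqrt (real n)) = a k n) sequentially"
      using eventually_ge_at_top[of k] by eventually_elim (simp add: a_def)
    ultimately show "(\<lambda>n. a k n) \<longlonglongrightarrow> b k"
      by (rule Lim_transform_eventually)
  next
    have "norm (a k n) \<le> real (Suc k) * (beta\<^sup>2) ^ k" for k n
    proof (cases "k \<le> n")
      case True
      \<comment> \<open>From \<open>n \<le> (n-k+1) (k+1)\<close> the bound on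
        \<open>cb (n - k)\<close> loses only a factor \<open>k + 1\<close>, which
        \<open>(beta^2)^k\<close> absorbs.\<close>
      have "(cb (n - k))\<^sup>2 * real n \<le> (cb (n - k))\<^sup>2 * (real (Suc (n - k)) * real (Suc k))"
      proof (intro mult_left_mono)
        from True obtain m where "n = k + m" using le_Suc_ex by blast
        then have "n \<le> Suc (n - k) * Suc k" by simp
        then show "real n \<le> real (Suc (n - k)) * real (Suc k)"
          by (metis of_nat_le_iff of_nat_mult)
      qed auto
      also have "\<dots> = ((cb (n - k))\<^sup>2 * real (Suc (n - k))) * real (Suc k)"
        by (simp only: mult.assoc)
      also have "\<dots> \<le> 1 * real (Suc k)"
        by (intro mult_right_mono cb_square_le) auto
      also have "\<dots> \<le> real (Suc k) * real (Suc k)" by (intro mult_right_mono) auto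
      finally have "(cb (n - k))\<^sup>2 * real n \<le> (real (Suc k))\<^sup>2"
        by (simp only: power2_eq_square)
      then have "(cb (n - k) * sqrt (real n))\<^sup>2 \<le> (real (Suc k))\<^sup>2"
        by (simp add: power_mult_distrib)
      then have c: "cb (n - k) * sqrt (real n) \<le> real (Suc k)"
        by (rule power2_le_imp_le) simp
      have "norm (a k n) = cb k * ((beta\<^sup>2) ^ k * (cb (n - k) * sqrt (real n)))"
        using True cb_nonneg by (simp add: a_def abs_mult mult.assoc)
      also have "\<dots> \<le> 1 * ((beta\<^sup>2) ^ k * real (Suc k))"
        using c cb_le_1 cb_nonneg by (intro mult_mono mult_left_mono) auto
      finally show ?thesis by (simp add: mult.commute)
    qed (simp add: a_def)
    then show "eventually (\<lambda>(k, n). norm (a k n) \<le> real (Suc k) * (beta\<^sup>2) ^ k) (at_top \<times>\<^sub>F sequentially)"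
      by (intro always_eventually) auto
    show "summable (\<lambda>k. real (Suc k) * (beta\<^sup>2) ^ k)"
      using geometric_deriv_sums[of "beta\<^sup>2"] q by (auto intro: sums_summable)
  qed auto
  moreover have "suminf b = kappa"
  proof -
    have "(\<lambda>n. cb n * (beta\<^sup>2) ^ n) sums (1 / sqrt (1 - beta\<^sup>2))"
      using sums_inv_sqrt_fps(1)[of 1 "beta\<^sup>2"] q by (simp add: inv_sqrt_fps_def cb_def)
    from sums_mult2[OF this, of "1 / sqrt pi"] have "b sums kappa"
      unfolding b_def kappa_def by (simp add: mult.commute)
    then show ?thesis by (rule sums_unique [symmetric])
  qed
  moreover have "suminf (\<lambda>k. a k n) = real (delannoy n) * nu n" for n
  proof -
    have "suminf (\<lambda>k. a k n) = (\<Sum>k\<le>n. a k n)"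
      by (rule suminf_finite) (auto simp: a_def)
    also have "\<dots> = (\<Sum>k\<le>n. (inv_sqrt_fps beta $ k * inv_sqrt_fps alpha $ (n - k)) * nu n)"
    proof (intro sum.cong refl)
      fix k assume "k \<in> {..n}"
      then have "alpha ^ n = alpha ^ k * alpha ^ (n - k)"
        by (simp flip: power_add)
      moreover have "beta ^ k * alpha ^ k = 1"
        using alpha_beta by (simp add: mult.commute flip: power_mult_distrib)
      then have "(beta\<^sup>2) ^ k = beta ^ k / alpha ^ k"
        using alpha_beta_bounds by (simp add: power2_eq_square power_mult_distrib field_simps)
      ultimately show "a k n = (inv_sqrt_fps beta $ k * inv_sqrt_fps alpha $ (n - k)) * nu n"
        using \<open>k \<in> {..n}\<close> alpha_beta_bounds
        by (simp add: a_def inv_sqrt_fps_def cb_def nu_def mult_ac)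
    qed
    also have "\<dots> = delannoy_fps $ n * nu n"
      by (simp add: delannoy_fps_eq mult.commute[of "inv_sqrt_fps alpha"] fps_mult_nth
          sum_distrib_right atMost_atLeast0)
    finally show ?thesis by (simp add: delannoy_fps_nth)
  qed
  ultimately show ?thesis by simp
qed

text \<open>Since \<open>Q = 1 - x - 2 x R\<close> is the square root of \<open>1 - 6 x + x\<^sup>2\<close>, it satisfies
  \<open>Q' = (x - 3) / Q\<close>.\<close>
lemma schr_delannoy:
  "2 * (real (Suc n) + 1) * real (schr (Suc n)) = 3 * real (delannoy (Suc n)) - real (delannoy n)"
proof -
  define Q where "Q = (1 - 6 * fps_X + fps_X\<^sup>2) * delannoy_fps"
  have Q: "Q * Q = 1 - 6 * fps_X + fps_X\<^sup>2" "Q * delannoy_fps = 1"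
    using delannoy_fps_square unfolding Q_def by algebra+
  have "fps_deriv (Q * Q) = 2 * fps_X - 6"
    unfolding Q(1) by (simp add: power2_eq_square)
  then have "2 * (Q * fps_deriv Q) = 2 * (fps_X - 3)"
    by (simp add: algebra_simps)
  then have "fps_deriv Q = (fps_X - 3) * delannoy_fps"
    using Q(2) by algebra
  moreover have "Q = 1 - fps_X - 2 * (fps_X * schroeder_fps)"
    by (simp add: Q_def mult.assoc flip: schroeder_fps_delannoy_fps)
  then have "fps_deriv Q = - 1 - fps_const 2 * fps_deriv (fps_X * schroeder_fps)"
    by (simp only: fps_deriv_sub fps_deriv_mult) (simp add: numeral_fps_const)
  ultimately have "- 1 - fps_const 2 * fps_deriv (fps_X * schroeder_fps)
      = fps_X * delannoy_fps - fps_const 3 * delannoy_fps"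
    by (simp add: left_diff_distrib numeral_fps_const)
  \<comment> \<open>The derivative of \<open>x R\<close> has the coefficient
    \<open>(n+2) r_(n+1)\<close> at \<open>x^(n+1)\<close>.\<close>
  from arg_cong[OF this, of "\<lambda>f. f $ Suc n"] show ?thesis
    by (simp add: schr_eq delannoy_fps_nth del: fps_deriv_mult) (simp add: algebra_simps)
qed

lemma nu_Suc_ratio: "(\<lambda>n. nu (Suc n) / nu n) \<longlonglongrightarrow> beta"
proof -
  have "(\<lambda>n. sqrt (real (Suc n) / real n) * beta) \<longlonglongrightarrow> 1 * beta"
    by (intro tendsto_mult tendsto_const) real_asymp
  moreover have beta: "beta = 1 / alpha"
    using alpha_beta(1) alpha_beta_bounds by (simp add: field_simps)
  have "sqrt (real (Suc n) / real n) * beta = nu (Suc n) / nu n" for n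
    unfolding beta nu_def real_sqrt_divide using alpha_beta_bounds by simp
  ultimately show ?thesis by simp
qed

lemma LIMSEQ_times_nu_Suc:
  assumes "(\<lambda>n. f n * nu n) \<longlonglongrightarrow> c"
  shows "(\<lambda>n. f n * nu (Suc n)) \<longlonglongrightarrow> c * beta"
proof (rule Lim_transform_eventually[OF tendsto_mult[OF assms nu_Suc_ratio]])
  show "eventually (\<lambda>n. f n * nu n * (nu (Suc n) / nu n) = f n * nu (Suc n)) sequentially"
    using eventually_gt_at_top[of 0]
    by eventually_elim (use alpha_beta_bounds in \<open>simp add: nu_def\<close>)
qed

text \<open>By \<open>schr_delannoy\<close> the limit is \<open>kappa (3 - beta) / 2\<close>, and
  \<open>3 - beta = 2 sqrt 2\<close>.\<close>

lemma schr_asymp: "(\<lambda>n. real n * real (schr n) * nu n) \<longlonglongrightarrow> kappa * sqrt 2"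
proof (rule filterlim_sequentially_Suc[THEN iffD1])
  have d: "(\<lambda>n. real (delannoy (Suc n)) * nu (Suc n)) \<longlonglongrightarrow> kappa"
    using delannoy_asymp by (rule LIMSEQ_Suc)
  have "(\<lambda>n. real (Suc n) / (2 * (real (Suc n) + 1))) \<longlonglongrightarrow> 1 / 2"
    by real_asymp
  note tendsto_mult[OF this tendsto_diff[OF tendsto_mult[OF tendsto_const d, of 3]
      LIMSEQ_times_nu_Suc[OF delannoy_asymp]]]
  moreover have "1 / 2 * (3 * kappa - kappa * beta) = kappa * sqrt 2"
    by (simp add: beta_def algebra_simps)
  moreover have "real (Suc n) / (2 * (real (Suc n) + 1)) *
      (3 * (real (delannoy (Suc n)) * nu (Suc n)) - real (delannoy n) * nu (Suc n)) =
      real (Suc n) * real (schr (Suc n)) * nu (Suc n)" for n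
  proof -
    have "3 * (real (delannoy (Suc n)) * nu (Suc n)) - real (delannoy n) * nu (Suc n)
       = 2 * (real (Suc n) + 1) * real (schr (Suc n)) * nu (Suc n)"
      unfolding schr_delannoy by (simp add: algebra_simps)
    moreover have "2 * (real (Suc n) + 1) \<noteq> 0"
      by (rule less_imp_neq [THEN not_sym], intro mult_pos_pos add_pos_pos) auto
    ultimately show ?thesis
      by simp
  qed
  ultimately show "(\<lambda>n. real (Suc n) * real (schr (Suc n)) * nu (Suc n)) \<longlonglongrightarrow> kappa * sqrt 2"
    by (simp only:)
qed

lemma schr_asymp_0: "(\<lambda>n. real (schr n) * nu n) \<longlonglongrightarrow> 0"
proof -
  have "(\<lambda>n. 1 / real n) \<longlonglongrightarrow> 0" by real_asymp
  from tendsto_mult[OF this schr_asymp]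
  have "(\<lambda>n. 1 / real n * (real n * real (schr n) * nu n)) \<longlonglongrightarrow> 0" by simp
  moreover have "eventually (\<lambda>n. 1 / real n * (real n * real (schr n) * nu n) = real (schr n) * nu n) sequentially"
    using eventually_gt_at_top[of 0] by eventually_elim simp
  ultimately show ?thesis by (rule Lim_transform_eventually)
qed

section \<open>Asymptotics of the number of edges and of the index\<close>

lemma ellS_times_nu: "(\<lambda>n. real (ellS n) * nu n) \<longlonglongrightarrow> kappa * (1 - beta)"
proof (rule filterlim_sequentially_Suc[THEN iffD1])
  have "(\<lambda>n. real (delannoy (Suc n)) * nu (Suc n) - real (schr (Suc n)) * nu (Suc n)
      - real (delannoy n) * nu (Suc n) + real (schr n) * nu (Suc n)) \<longlonglongrightarrow> kappa - 0 - kappa * beta + 0 * beta"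
    by (intro tendsto_intros LIMSEQ_times_nu_Suc delannoy_asymp schr_asymp_0
        LIMSEQ_Suc[OF delannoy_asymp] LIMSEQ_Suc[OF schr_asymp_0])
  then show "(\<lambda>n. real (ellS (Suc n)) * nu (Suc n)) \<longlonglongrightarrow> kappa * (1 - beta)"
    by (simp add: ellS_Suc algebra_simps)
qed

lemma kappa_pos: "0 < kappa"
  using alpha_beta_bounds by (simp add: kappa_def abs_square_less_1)

text \<open>The identity \<open>(1 - beta)^2 sqrt 2 = 1 - beta^2\<close> simplifies the limit
  constant to \<open>1 / sqrt (sqrt 2 pi)\<close>.\<close>

lemma kappa_beta: "kappa * (1 - beta) * sqrt (sqrt 2 * pi) = 1"
proof -
  have "(1 - beta)\<^sup>2 * sqrt 2 = 1 - beta\<^sup>2"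
    by (simp add: beta_def power2_eq_square algebra_simps)
  then have "sqrt ((1 - beta)\<^sup>2) * sqrt (sqrt 2) = sqrt (1 - beta\<^sup>2)"
    by (simp only: flip: real_sqrt_mult)
  then have "(1 - beta) * sqrt (sqrt 2) = sqrt (1 - beta\<^sup>2)"
    using alpha_beta_bounds by simp
  moreover have "sqrt (1 - beta\<^sup>2) \<noteq> 0"
    using kappa_pos by (auto simp: kappa_def)
  moreover have "kappa * (1 - beta) * sqrt (sqrt 2 * pi)
     = ((1 - beta) * sqrt (sqrt 2)) * sqrt pi / (sqrt (1 - beta\<^sup>2) * sqrt pi)"
    by (simp add: kappa_def real_sqrt_mult)
  ultimately show ?thesis
    by (simp only:) simp
qed

lemma ellS_asymp: "(\<lambda>n. real (ellS n)) \<sim>[at_top] (\<lambda>n. (1 + sqrt 2) ^ (2 * n) / sqrt (sqrt 2 * real n * pi))"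
proof (rule asymp_equivI')
  have "(1 + sqrt 2)\<^sup>2 = alpha"
    by (simp add: alpha_def power2_eq_square algebra_simps)
  then have alpha: "(1 + sqrt 2) ^ (2 * n) = alpha ^ n" for n
    by (simp only: power_mult)
  have "real (ellS n) * nu n * sqrt (sqrt 2 * pi)
      = real (ellS n) / ((1 + sqrt 2) ^ (2 * n) / sqrt (sqrt 2 * real n * pi))" for n
    unfolding alpha by (simp add: nu_def real_sqrt_mult)
  then show "(\<lambda>n. real (ellS n) / ((1 + sqrt 2) ^ (2 * n) / sqrt (sqrt 2 * real n * pi))) \<longlonglongrightarrow> 1"
    using tendsto_mult[OF ellS_times_nu tendsto_const[of "sqrt (sqrt 2 * pi)"]]
    by (simp add: kappa_beta)
qed

lemma index_asymp: "(\<lambda>n. index_poset (schroeder n) (below n)) \<sim>[at_top] (\<lambda>n. (2 - sqrt 2) * real n)"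
proof (rule asymp_equivI')
  have "(1 - beta) / sqrt 2 = 2 - sqrt 2"
    by (simp add: beta_def field_simps)
  then have "kappa * (1 - beta) / (kappa * sqrt 2) = 2 - sqrt 2"
    using kappa_pos by simp
  with tendsto_divide[OF ellS_times_nu schr_asymp] kappa_pos
  have "(\<lambda>n. real (ellS n) * nu n / (real n * real (schr n) * nu n)) \<longlonglongrightarrow> 2 - sqrt 2"
    by simp
  moreover have "sqrt 2 < 2"
    by (rule real_less_lsqrt) simp_all
  ultimately have "(\<lambda>n. real (ellS n) * nu n / (real n * real (schr n) * nu n) / (2 - sqrt 2)) \<longlonglongrightarrow> 1"
    using tendsto_divide[of _ "2 - sqrt 2" _ "\<lambda>_. 2 - sqrt 2" "2 - sqrt 2"] by simp
  moreover have "eventually (\<lambda>n. real (ellS n) * nu n / (real n * real (schr n) * nu n) / (2 - sqrt 2)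
      = index_poset (schroeder n) (below n) / ((2 - sqrt 2) * real n)) sequentially"
    using eventually_gt_at_top[of 0]
  proof eventually_elim
    case (elim n)
    then have "nu n \<noteq> 0" using alpha_beta_bounds by (simp add: nu_def)
    then show ?case
      by (simp add: index_poset_def ellS_def schr_def mult_ac)
  qed
  ultimately show "(\<lambda>n. index_poset (schroeder n) (below n) / ((2 - sqrt 2) * real n)) \<longlonglongrightarrow> 1"
    by (rule Lim_transform_eventually)
qed

theorem mainTheorem13:
  shows "(\<forall>x::real. 0 < \<bar>x\<bar> \<and> \<bar>x\<bar> < 3 - 2 * sqrt 2 \<longrightarrow>
            (\<lambda>n. real (ellS n) * x ^ n) sums
              ((1 - x) * (1 - 4 * x + x\<^sup>2 - (1 - x) * sqrt (1 - 6 * x + x\<^sup>2))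
                / (2 * x * sqrt (1 - 6 * x + x\<^sup>2))))
    \<and> (\<forall>n\<ge>1. int (ellS n) = int (delannoy n) - int (schr n) - int (delannoy (n - 1)) + int (schr (n - 1)))
    \<and> (\<forall>n. real (ellS n) = (\<Sum>k = 0..n. multichoose (2 * k) (n - k) * real ((2 * k) choose k) * real k / real (k + 1)))
    \<and> ((\<lambda>n. real (ellS n)) \<sim>[at_top] (\<lambda>n. (1 + sqrt 2) ^ (2 * n) / sqrt (sqrt 2 * real n * pi)))
    \<and> ((\<lambda>n. index_poset (schroeder n) (below n)) \<sim>[at_top] (\<lambda>n. (2 - sqrt 2) * real n))"
proof (intro conjI allI impI)
  fix x :: real assume "0 < \<bar>x\<bar> \<and> \<bar>x\<bar> < 3 - 2 * sqrt 2"
  then show "(\<lambda>n. real (ellS n) * x ^ n) sums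
              ((1 - x) * (1 - 4 * x + x\<^sup>2 - (1 - x) * sqrt (1 - 6 * x + x\<^sup>2))
                / (2 * x * sqrt (1 - 6 * x + x\<^sup>2)))"
    by (intro sums_ellS) (auto simp: beta_def)
next
  fix n :: nat assume "1 \<le> n"
  then obtain m where "n = Suc m" by (cases n) auto
  then show "int (ellS n) = int (delannoy n) - int (schr n) - int (delannoy (n - 1)) + int (schr (n - 1))"
    using ellS_Suc[of m] by simp
qed (rule ellS_eq_sum ellS_asymp index_asymp)+

end
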